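(* Suppose the sequence of statistical models $\{P_{n,\theta}\}$ satisfies the following assumption (Assumption A): for any $\varepsilon>0$ and any $\theta\in\Theta$ there exist a positive integer $N$ and a neighborhood $O\subseteq\Theta$ of $\theta$ such that, for all $n\ge N$ and all $\theta_1,\theta_2\in O$, $$\pi(P_{n,\theta_1},P_{n,\theta_2})\ \ge\ \Phi\left(-\frac{|\theta_2-\theta_1|\sqrt{nI(\theta)}}{2}\right)-\varepsilon .$$ Let $\{T_n\}$ be a computable estimator for $\{P_{n,\theta}\}$. Then for any $c>0$ and any noncomputable $\theta\in\Theta$, $$\limsup_{n\to\infty}P_{n,\theta}\left(|T_n-\theta|>cn^{-1/2}\right)\ \ge\ \Phi\left(-c\sqrt{I(\theta)}\right).$$
   Context: Setting: $\Omega_1,\Omega_2,\ldots$ is a sequence of measurable spaces; $\Theta$ is an open interval of the real line (possibly $\Theta=\mathbb{R}$) whose end-points are computable ($\pm\infty$ count as computable); for each $n\in\{1,2,\ldots\}$, $\{P_{n,\theta}\mid\theta\in\Theta\}$ is a family of probability measures on $\Omega_n$. An estimator $T=\{T_n\}_{n=1}^\infty$ for $\{P_{n,\theta}\}$ is a sequence of measurable functions $T_n:\Omega_n\to\Theta$. $I:\Theta\to(0,\infty)$ is a fixed continuous function. $\Phi$ is the distribution function of the standard normal distribution $N(0,1)$. Affinity: for probability measures $P,Q$ on the same measurable space $\Omega$, $\pi(P,Q):=\inf_E\max(P(E),Q(\Omega\setminus E))$, with $E$ ranging over the measurable sets in $\Omega$. Computability: computability of functions between spaces of finite objects (such as $\mathbb{N}$,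 $\mathbb{Q}$, the open intervals with rational end-points, and their finite products, under standard codings by positive integers) is the usual Turing computability. A real number $t$ is computable if there is a computable function $F:\mathbb{N}\to\mathbb{N}$ with $\bigl||t|-F(n)/n\bigr|\le 1/n$ for all $n\in\mathbb{N}=\{1,2,\ldots\}$. Sets $A_x\subseteq\mathbb{R}$ indexed by $x\in X$, where $X$ is a space of finite objects, are effectively open uniformly in $x$ if $A_x=\bigcup_{i\in\mathbb{N}}(a_i(x),b_i(x))$ for all $x$, where $(i,x)\mapsto(a_i(x),b_i(x))$ is a computable function from $\mathbb{N}\times X$ to open intervals with rational end-points (with $(a,b)=\emptyset$ when $a\ge b$); the complementary sets $\mathbb{R}\setminus A_x$ are then said to be effectively closed uniformly in $x$. An estimator $\{T_n\}$ for $\{P_{n,\theta}\}$ is computable if, for each $\delta\in\mathbb{Q}\cap[0,1)$, the closures (in $\mathbb{R}$) $$\overline{\{q\in\Theta\mid P_{n,q}(|T_n-q|>u)\le\delta\}}$$ are effectively closed uniformly in $n\in\mathbb{N}$ and $u\in\mathbb{Q}\cap[0,\infty)$. *)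

theory Defs
  imports "HOL-Probability.Probability" "HOL-Library.Nat_Bijection"
begin

text \<open>
  Total Turing-computable functions in Kleene's form: the smallest class containing the initial
  functions and closed under composition, primitive recursion and minimization of regular
  functions.  A function of arity \<open>k\<close> takes its arguments as a list of length \<open>k\<close>; its values on
  lists of any other length carry no meaning.
\<close>

inductive total_recursive :: "nat \<Rightarrow> (nat list \<Rightarrow> nat) \<Rightarrow> bool" where
  zero: "total_recursive k (\<lambda>_. 0)"
| succ: "total_recursive 1 (\<lambda>xs. Suc (xs ! 0))"
| proj: "i < k \<Longrightarrow> total_recursive k (\<lambda>xs. xs ! i)"
| comp: "total_recursive (length gs) f \<Longrightarrow> (\<forall>g\<in>set gs. total_recursive k g) \<Longrightarrow>
    total_recursive k (\<lambda>xs. f (map (\<lambda>g. g xs) gs))"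
| prim_rec: "total_recursive k f \<Longrightarrow> total_recursive (Suc (Suc k)) g \<Longrightarrow>
    total_recursive (Suc k)
      (\<lambda>xs. rec_nat (f (tl xs)) (\<lambda>y r. g (y # r # tl xs)) (hd xs))"
| minimization: "total_recursive (Suc k) f \<Longrightarrow>
    (\<forall>xs. length xs = k \<longrightarrow> (\<exists>y. f (y # xs) = 0)) \<Longrightarrow>
    total_recursive k (\<lambda>xs. LEAST y. f (y # xs) = 0)"

class finite_object =
  fixes encode :: "'a \<Rightarrow> nat"
  assumes inj_encode: "inj encode"

instantiation nat :: finite_object
begin
definition encode_nat :: "nat \<Rightarrow> nat" where "encode_nat n = n"
instance by standard (simp add: encode_nat_def inj_def)
end

instantiation int :: finite_object
begin
definition encode_int :: "int \<Rightarrow> nat" where "encode_int k = int_encode k"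
instance by standard (simp add: encode_int_def inj_def int_encode_eq)
end

instantiation prod :: (finite_object, finite_object) finite_object
begin
definition encode_prod :: "'a \<times> 'b \<Rightarrow> nat" where
  "encode_prod p = prod_encode (encode (fst p), encode (snd p))"
instance
  by standard (auto simp: encode_prod_def inj_def prod_eq_iff dest: injD[OF inj_encode])
end

instantiation rat :: finite_object
begin
definition encode_rat :: "rat \<Rightarrow> nat" where "encode_rat r = encode (quotient_of r)"
instance
  by standard (auto simp: encode_rat_def inj_def dest!: injD[OF inj_encode]
    intro: quotient_of_inject)
end

text \<open>
  \<open>X\<close> is meant to be a set whose codes form a decidable set, so that a computable function on \<open>X\<close>
  always extends to a total recursive function on codes.
\<close>

definition computable_on :: "'a::finite_object set \<Rightarrow> ('a \<Rightarrow> 'b::finite_object) \<Rightarrow> bool" where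
  "computable_on X f \<longleftrightarrow>
     (\<exists>g. total_recursive 1 g \<and> (\<forall>x\<in>X. g [encode x] = encode (f x)))"

text \<open>In the definitions below the natural numbers begin with 1.\<close>

definition computable_real :: "real \<Rightarrow> bool" where
  "computable_real t \<longleftrightarrow>
     (\<exists>F::nat \<Rightarrow> nat. computable_on {1..} F \<and>
        (\<forall>n\<ge>1. F n \<ge> 1 \<and> \<bar>\<bar>t\<bar> - real (F n) / real n\<bar> \<le> 1 / real n))"

definition computable_endpoint :: "ereal \<Rightarrow> bool" where
  "computable_endpoint e \<longleftrightarrow>
     e = \<infinity> \<or> e = -\<infinity> \<or> (\<exists>t. e = ereal t \<and> computable_real t)"

text \<open>A rational interval is given by its pair of end-points, and is empty if \<open>a \<ge> b\<close>.\<close>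

definition effectively_open_on :: "'x::finite_object set \<Rightarrow> ('x \<Rightarrow> real set) \<Rightarrow> bool" where
  "effectively_open_on X A \<longleftrightarrow>
     (\<exists>a b :: nat \<Rightarrow> 'x \<Rightarrow> rat.
        computable_on ({1..} \<times> X) (\<lambda>(i, x). (a i x, b i x)) \<and>
        (\<forall>x\<in>X. A x = (\<Union>i\<in>{1..}. {real_of_rat (a i x)<..<real_of_rat (b i x)})))"

definition effectively_closed_on :: "'x::finite_object set \<Rightarrow> ('x \<Rightarrow> real set) \<Rightarrow> bool" where
  "effectively_closed_on X A \<longleftrightarrow> effectively_open_on X (\<lambda>x. - A x)"

definition affinity :: "'a measure \<Rightarrow> 'a measure \<Rightarrow> real" where
  "affinity P Q = (INF E\<in>sets P. max (measure P E) (measure Q (space P - E)))"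

abbreviation std_normal_cdf :: "real \<Rightarrow> real" where
  "std_normal_cdf \<equiv> cdf std_normal_distribution"

text \<open>Only the measurable structure of \<open>\<Omega> n\<close> is relevant here, not its measure.\<close>

definition statistical_models ::
    "(nat \<Rightarrow> 'a measure) \<Rightarrow> real set \<Rightarrow> (nat \<Rightarrow> real \<Rightarrow> 'a measure) \<Rightarrow> bool" where
  "statistical_models \<Omega> \<Theta> P \<longleftrightarrow>
     (\<forall>n\<ge>1. \<forall>\<theta>\<in>\<Theta>. prob_space (P n \<theta>) \<and> sets (P n \<theta>) = sets (\<Omega> n))"

definition estimator :: "(nat \<Rightarrow> 'a measure) \<Rightarrow> real set \<Rightarrow> (nat \<Rightarrow> 'a \<Rightarrow> real) \<Rightarrow> bool" where
  "estimator \<Omega> \<Theta> T \<longleftrightarrow> (\<forall>n\<ge>1. T n \<in> \<Omega> n \<rightarrow>\<^sub>M restrict_space borel \<Theta>)"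

definition computable_estimator ::
    "(nat \<Rightarrow> 'a measure) \<Rightarrow> real set \<Rightarrow> (nat \<Rightarrow> real \<Rightarrow> 'a measure) \<Rightarrow>
     (nat \<Rightarrow> 'a \<Rightarrow> real) \<Rightarrow> bool" where
  "computable_estimator \<Omega> \<Theta> P T \<longleftrightarrow>
     estimator \<Omega> \<Theta> T \<and>
     (\<forall>\<delta>::rat. 0 \<le> \<delta> \<and> \<delta> < 1 \<longrightarrow>
        effectively_closed_on ({1..} \<times> {0..}) (\<lambda>(n::nat, u::rat).
          closure {q \<in> \<Theta>.
            measure (P n q) {\<omega> \<in> space (\<Omega> n). \<bar>T n \<omega> - q\<bar> > real_of_rat u} \<le> real_of_rat \<delta>}))"

definition assumption_A ::
    "real set \<Rightarrow> (real \<Rightarrow> real) \<Rightarrow> (nat \<Rightarrow> real \<Rightarrow> 'a measure) \<Rightarrow> bool" where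
  "assumption_A \<Theta> I P \<longleftrightarrow>
     (\<forall>\<epsilon>>0. \<forall>\<theta>\<in>\<Theta>. \<exists>N\<ge>1. \<exists>U. open U \<and> \<theta> \<in> U \<and> U \<subseteq> \<Theta> \<and>
        (\<forall>n\<ge>N. \<forall>\<theta>\<^sub>1\<in>U. \<forall>\<theta>\<^sub>2\<in>U.
           affinity (P n \<theta>\<^sub>1) (P n \<theta>\<^sub>2)
             \<ge> std_normal_cdf (- (\<bar>\<theta>\<^sub>2 - \<theta>\<^sub>1\<bar> * sqrt (real n * I \<theta>) / 2)) - \<epsilon>))"

end

theory Submission
  imports Defs
begin

text \<open>
  Suppose the limsup is smaller than the normal bound. Write $n$ for the sample size. At the true value
  \<open>\<theta>\<close> the estimator then misses by more than $c n^{-1/2}$ with probability at most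
  \<open>\<delta>\<close>, for some rational \<open>\<delta>\<close> below the bound and all large $n$.
  Two parameters with this property at the same large $n$, both close to \<open>\<theta>\<close>, cannot
  have an arbitrary distance: if they are further apart than $2 c n^{-1/2}$, then missing the first
  parameter is a test that separates the two models with both errors at most \<open>\<delta>\<close>, so
  their affinity is at most \<open>\<delta>\<close> (\<open>affinity_le_of_accurate_estimator\<close>).
  The normal lower bound on the affinity forbids this unless their distance is at least $2 c' n^{-1/2}$
  for a certain $c' > c$. Near \<open>\<theta>\<close>, the distance to \<open>\<theta>\<close> thus
  avoids the window from $2 c n^{-1/2}$ to $2 c' n^{-1/2}$. As $n$ varies, these windows overlap and
  fill a whole interval $(0, e)$, because the ratio of consecutive window positions tends to 1 while
  $c'/c > 1$ stays fixed.

  Hence \<open>\<theta>\<close> is an isolated point of the intersection, over all large $n$, of the closures of the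
  sets of parameters at which the estimator is this accurate; passing to closures is harmless
  because the windows are open. The computability of the estimator makes this
  intersection effectively closed, and an isolated point of an effectively closed set is computable:
  a compact rational interval around \<open>\<theta>\<close> in which \<open>\<theta>\<close> is the only point of the set is covered by
  a small interval around \<open>\<theta>\<close> together with finitely many of the enumerated complementary
  intervals, and one can search for such a finite cover
  (\<open>computable_real_isolated\<close>, \<open>computable_real_isolated_Inter\<close>). So \<open>\<theta>\<close> is computable.

  To keep the effective part elementary, only sample sizes $n = (kL)^2$ are used, with the
  tolerance $u = 1/(qL)$, where $k/q$ is a rational number between $c$ and $c'$. Then
  $u = (k/q) n^{-1/2}$ is rational, already in lowest terms, and its code is a polynomial in $L$.
\<close>

section \<open>Recursive functions and decidable predicates\<close>

text \<open>
  The values of a total recursive function on argument lists of the wrong length are an artefact of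
  how it is built. Identifying functions that agree on lists of length \<open>k\<close> gives a class that is
  closed under rewriting of the function, so closure rules can be stated for the expected terms.
\<close>

definition recursive :: "nat \<Rightarrow> (nat list \<Rightarrow> nat) \<Rightarrow> bool" where
  "recursive k f \<longleftrightarrow> (\<exists>g. total_recursive k g \<and> (\<forall>xs. length xs = k \<longrightarrow> g xs = f xs))"

text \<open>
  Truth is coded by 0, which is the value that minimization searches for.
\<close>

definition decidable :: "nat \<Rightarrow> (nat list \<Rightarrow> bool) \<Rightarrow> bool" where
  "decidable k Q \<longleftrightarrow> recursive k (\<lambda>xs. if Q xs then 0 else 1)"

lemma recursive_total: "total_recursive k f \<Longrightarrow> recursive k f"
  unfolding recursive_def by blast

lemma recursive_cong:
  "recursive k f \<Longrightarrow> (\<And>xs. length xs = k \<Longrightarrow> f xs = g xs) \<Longrightarrow> recursive k g"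
  unfolding recursive_def by metis

lemma recursive_nth [intro!]: "i < k \<Longrightarrow> recursive k (\<lambda>xs. xs ! i)"
  by (intro recursive_total total_recursive.proj)

lemma recursive_compose:
  assumes "recursive (length gs) f" and "\<forall>g\<in>set gs. recursive k g"
  shows "recursive k (\<lambda>xs. f (map (\<lambda>g. g xs) gs))"
proof -
  obtain f' where f': "total_recursive (length gs) f'" "\<And>ys. length ys = length gs \<Longrightarrow> f' ys = f ys"
    using assms(1) unfolding recursive_def by blast
  obtain h where h: "\<And>g. g \<in> set gs \<Longrightarrow> total_recursive k (h g)"
      "\<And>g xs. g \<in> set gs \<Longrightarrow> length xs = k \<Longrightarrow> h g xs = g xs"
    using assms(2) unfolding recursive_def by metis
  have "total_recursive k (\<lambda>xs. f' (map (\<lambda>g. g xs) (map h gs)))"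
    using f' h by (intro total_recursive.comp) auto
  moreover have "f' (map (\<lambda>g. g xs) (map h gs)) = f (map (\<lambda>g. g xs) gs)" if "length xs = k" for xs
  proof -
    have "map (\<lambda>g. g xs) (map h gs) = map (\<lambda>g. g xs) gs"
      using h that by simp
    then show ?thesis using f'(2)[of "map (\<lambda>g. g xs) gs"] by (simp del: map_map)
  qed
  ultimately show ?thesis unfolding recursive_def by blast
qed

lemma recursive_compose1:
  "recursive 1 (\<lambda>xs. F (xs ! 0)) \<Longrightarrow> recursive k f \<Longrightarrow> recursive k (\<lambda>xs. F (f xs))"
  using recursive_compose[of "[f]" "\<lambda>xs. F (xs ! 0)" k] by simp

lemma recursive_compose2:
  "recursive 2 (\<lambda>xs. F (xs ! 0) (xs ! 1)) \<Longrightarrow> recursive k f \<Longrightarrow> recursive k g \<Longrightarrow>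
     recursive k (\<lambda>xs. F (f xs) (g xs))"
  using recursive_compose[of "[f, g]" "\<lambda>xs. F (xs ! 0) (xs ! 1)" k] by (simp add: numeral_2_eq_2)

lemma recursive_rec_nat:
  assumes b: "recursive 1 (\<lambda>xs. b (xs ! 0))"
    and s: "recursive 3 (\<lambda>xs. s (xs ! 0) (xs ! 1) (xs ! 2))"
    and "recursive k f" and "recursive k g"
  shows "recursive k (\<lambda>xs. rec_nat (b (g xs)) (\<lambda>y r. s y r (g xs)) (f xs))"
proof (rule recursive_compose2[OF _ assms(3,4)])
  obtain b' s' where b': "total_recursive 1 b'" "\<And>x. b' [x] = b x"
    and s': "total_recursive (Suc (Suc 1)) s'" "\<And>x y z. s' [x, y, z] = s x y z"
    using b s unfolding recursive_def by (fastforce simp: numeral_eq_Suc)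
  have eq: "rec_nat (b' [n]) (\<lambda>y r. s' [y, r, n]) m = rec_nat (b n) (\<lambda>y r. s y r n) m" for m n
    by (simp only: b' s')
  show "recursive 2 (\<lambda>xs. rec_nat (b (xs ! 1)) (\<lambda>y r. s y r (xs ! 1)) (xs ! 0))"
    using total_recursive.prim_rec[OF b'(1) s'(1)]
    unfolding recursive_def numeral_2_eq_2
    by (intro exI conjI) (auto simp: eq length_Suc_conv)
qed

lemma recursive_Least:
  assumes "decidable (Suc k) Q" and "\<And>xs. length xs = k \<Longrightarrow> \<exists>y. Q (y # xs)"
  shows "recursive k (\<lambda>xs. LEAST y. Q (y # xs))"
proof -
  obtain f where f: "total_recursive (Suc k) f"
      "\<And>ys. length ys = Suc k \<Longrightarrow> f ys = (if Q ys then 0 else 1)"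
    using assms(1) unfolding decidable_def recursive_def by blast
  have eq: "f (y # xs) = 0 \<longleftrightarrow> Q (y # xs)" if "length xs = k" for y xs
    using f(2)[of "y # xs"] that by simp
  have "total_recursive k (\<lambda>xs. LEAST y. f (y # xs) = 0)"
    using f(1) eq assms(2) by (intro total_recursive.minimization) auto
  then show ?thesis
    using eq unfolding recursive_def by fastforce
qed

lemma recursive_Suc [intro!]: "recursive k f \<Longrightarrow> recursive k (\<lambda>xs. Suc (f xs))"
  using recursive_compose1[of Suc k f] recursive_total[OF total_recursive.succ] by simp

lemma recursive_const [intro!]: "recursive k (\<lambda>_. n)"
  by (induction n) (auto intro: recursive_total total_recursive.zero)

lemma recursive_add [intro!]:
  assumes "recursive k f" "recursive k g"
  shows "recursive k (\<lambda>xs. f xs + g xs)"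
proof -
  have "rec_nat n (\<lambda>y r. Suc r) m = m + n" for m n :: nat
    by (induction m) auto
  moreover have "recursive k (\<lambda>xs. rec_nat (g xs) (\<lambda>y r. Suc r) (f xs))"
    by (rule recursive_rec_nat[where b = "\<lambda>n. n" and s = "\<lambda>y r n. Suc r"])
      (use assms in auto)
  ultimately show ?thesis by simp
qed

lemma recursive_mult [intro!]:
  assumes "recursive k f" "recursive k g"
  shows "recursive k (\<lambda>xs. f xs * g xs)"
proof -
  have "rec_nat 0 (\<lambda>y r. r + n) m = m * n" for m n :: nat
    by (induction m) auto
  moreover have "recursive k (\<lambda>xs. rec_nat 0 (\<lambda>y r. r + g xs) (f xs))"
    by (rule recursive_rec_nat[where b = "\<lambda>n. 0" and s = "\<lambda>y r n. r + n"])
      (use assms in auto)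
  ultimately show ?thesis by simp
qed

lemma recursive_pred:
  assumes "recursive k f"
  shows "recursive k (\<lambda>xs. f xs - 1)"
proof -
  have "rec_nat 0 (\<lambda>y r. y) m = m - 1" for m :: nat
    by (cases m) auto
  moreover have "recursive k (\<lambda>xs. rec_nat 0 (\<lambda>y r. y) (f xs))"
    by (rule recursive_rec_nat[where b = "\<lambda>n. 0" and s = "\<lambda>y r n. y"])
      (use assms in auto)
  ultimately show ?thesis by simp
qed

lemma recursive_diff [intro!]:
  assumes "recursive k f" "recursive k g"
  shows "recursive k (\<lambda>xs. f xs - g xs)"
proof -
  have "rec_nat n (\<lambda>y r. r - 1) m = n - m" for m n :: nat
    by (induction m) auto
  moreover have "recursive k (\<lambda>xs. rec_nat (f xs) (\<lambda>y r. r - 1) (g xs))"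
    by (rule recursive_rec_nat[where b = "\<lambda>n. n" and s = "\<lambda>y r n. r - 1"])
      (use assms in \<open>auto intro!: recursive_pred[simplified]\<close>)
  ultimately show ?thesis by simp
qed

lemma decidable_less [intro!]:
  assumes "recursive k f" "recursive k g"
  shows "decidable k (\<lambda>xs. f xs < g xs)"
  unfolding decidable_def
  by (rule recursive_cong[of _ "\<lambda>xs. 1 - (g xs - f xs)"]) (use assms in auto)

lemma decidable_not [intro!]: "decidable k Q \<Longrightarrow> decidable k (\<lambda>xs. \<not> Q xs)"
  unfolding decidable_def
  by (rule recursive_cong[of _ "\<lambda>xs. 1 - (if Q xs then 0 else 1)"]) auto

lemma decidable_conj [intro!]:
  "decidable k Q \<Longrightarrow> decidable k R \<Longrightarrow> decidable k (\<lambda>xs. Q xs \<and> R xs)"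
  unfolding decidable_def
  by (rule recursive_cong[of _ "\<lambda>xs. 1 - (1 - ((if Q xs then 0 else 1) + (if R xs then 0 else 1)))"])
    auto

lemma decidable_disj [intro!]:
  "decidable k Q \<Longrightarrow> decidable k R \<Longrightarrow> decidable k (\<lambda>xs. Q xs \<or> R xs)"
  using decidable_not[OF decidable_conj[OF decidable_not decidable_not], of k Q R] by simp

lemma decidable_le [intro!]:
  "recursive k f \<Longrightarrow> recursive k g \<Longrightarrow> decidable k (\<lambda>xs. f xs \<le> g xs)"
  using decidable_not[OF decidable_less, of k g f] by (simp add: not_less)

lemma recursive_tl: "recursive k f \<Longrightarrow> recursive (Suc k) (\<lambda>xs. f (tl xs))"
proof -
  assume "recursive k f"
  then have "recursive (Suc k) (\<lambda>xs. f (map (\<lambda>g. g xs) (map (\<lambda>i xs. xs ! Suc i) [0..<k])))"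
    by (intro recursive_compose) auto
  then show ?thesis
    by (rule recursive_cong) (auto intro!: arg_cong[of _ _ f] nth_equalityI simp: nth_tl)
qed

text \<open>
  A bounded quantifier is an unbounded search that is stopped once it passes the bound: the least
  \<open>y\<close> that is a witness or exceeds the bound is itself within the bound iff there is a witness.
\<close>

lemma decidable_Ex_le:
  assumes "decidable (Suc k) Q" and "recursive k b"
  shows "decidable k (\<lambda>xs. \<exists>y\<le>b xs. Q (y # xs))"
proof -
  have "decidable (Suc k) (\<lambda>ys. Q ys \<or> b (tl ys) < ys ! 0)"
    using assms by (intro decidable_disj decidable_less recursive_tl recursive_nth) auto
  then have "recursive k (\<lambda>xs. LEAST y. Q (y # xs) \<or> b (tl (y # xs)) < (y # xs) ! 0)"
    by (rule recursive_Least) (auto intro!: exI[of _ "Suc _"])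
  then have "decidable k (\<lambda>xs. (LEAST y. Q (y # xs) \<or> b xs < y) \<le> b xs)"
    using assms(2) by (intro decidable_le) simp_all
  moreover have "(LEAST y. Q (y # xs) \<or> b xs < y) \<le> b xs \<longleftrightarrow> (\<exists>y\<le>b xs. Q (y # xs))" for xs
  proof
    assume "(LEAST y. Q (y # xs) \<or> b xs < y) \<le> b xs"
    moreover have "Q ((LEAST y. Q (y # xs) \<or> b xs < y) # xs)
        \<or> b xs < (LEAST y. Q (y # xs) \<or> b xs < y)"
      by (rule LeastI[of _ "Suc (b xs)"]) simp
    ultimately show "\<exists>y\<le>b xs. Q (y # xs)" by auto
  next
    assume "\<exists>y\<le>b xs. Q (y # xs)"
    then obtain y where "y \<le> b xs" "Q (y # xs)"
      by blast
    then show "(LEAST y. Q (y # xs) \<or> b xs < y) \<le> b xs"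
      by (intro order.trans[OF Least_le[of _ y]]) simp_all
  qed
  ultimately show ?thesis by simp
qed

lemma decidable_All_le:
  assumes "decidable (Suc k) Q" and "recursive k b"
  shows "decidable k (\<lambda>xs. \<forall>y\<le>b xs. Q (y # xs))"
  using decidable_not[OF decidable_Ex_le[OF decidable_not[OF assms(1)] assms(2)]] by simp

lemma recursive_div_2 [intro!]:
  assumes "recursive k f"
  shows "recursive k (\<lambda>xs. f xs div 2)"
proof (rule recursive_compose1[OF _ assms])
  have "recursive 1 (\<lambda>xs. LEAST y. (y # xs) ! 1 < 2 * Suc ((y # xs) ! 0))"
  proof (rule recursive_Least)
    fix xs :: "nat list"
    show "\<exists>y. (y # xs) ! 1 < 2 * Suc ((y # xs) ! 0)"
      by (rule exI[of _ "xs ! 0"]) simp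
  qed auto
  moreover have "(LEAST y. x < 2 * Suc y) = x div 2" for x :: nat
    by (rule Least_equality) auto
  ultimately show "recursive 1 (\<lambda>xs. xs ! 0 div 2)"
    by simp
qed

lemma recursive_mod_2 [intro!]: "recursive k f \<Longrightarrow> recursive k (\<lambda>xs. f xs mod 2)"
  by (simp only: minus_mult_div_eq_mod [symmetric]) auto

lemma recursive_triangle [intro!]: "recursive k f \<Longrightarrow> recursive k (\<lambda>xs. triangle (f xs))"
  unfolding triangle_def by auto

lemma recursive_prod_encode [intro!]:
  "recursive k f \<Longrightarrow> recursive k g \<Longrightarrow> recursive k (\<lambda>xs. prod_encode (f xs, g xs))"
  unfolding prod_encode_def by auto

text \<open>
  The code of \<open>(m, n)\<close> lies in the \<open>(m + n)\<close>-th block between consecutive triangular numbers. The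
  block is found by a search, which makes both projections recursive.
\<close>

lemma prod_decode_components:
  defines "d \<equiv> \<lambda>c. LEAST s. c < triangle (Suc s)"
  shows "fst (prod_decode c) = c - triangle (d c)"
    and "snd (prod_decode c) = d c - (c - triangle (d c))"
proof -
  obtain m n where c: "c = prod_encode (m, n)"
    by (metis prod_decode_inverse surj_pair)
  have mono: "triangle a \<le> triangle b" if "a \<le> b" for a b
    using that by (rule lift_Suc_mono_le[rotated]) simp
  have "d c = m + n"
    unfolding d_def
  proof (rule Least_equality)
    show "c < triangle (Suc (m + n))"
      by (simp add: c prod_encode_def)
  next
    fix s assume "c < triangle (Suc s)"
    then show "m + n \<le> s"
      using mono[of "Suc s" "m + n"] by (force simp: c prod_encode_def not_le[symmetric])
  qed
  then show "fst (prod_decode c) = c - triangle (d c)"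
    and "snd (prod_decode c) = d c - (c - triangle (d c))"
    by (simp_all add: c) (simp_all add: prod_encode_def)
qed

lemma recursive_fst_decode [intro!]: "recursive k f \<Longrightarrow> recursive k (\<lambda>xs. fst (prod_decode (f xs)))"
  and recursive_snd_decode [intro!]: "recursive k f \<Longrightarrow> recursive k (\<lambda>xs. snd (prod_decode (f xs)))"
proof -
  have "recursive 1 (\<lambda>xs. LEAST s. (s # xs) ! 1 < triangle (Suc ((s # xs) ! 0)))"
  proof (rule recursive_Least)
    fix xs :: "nat list"
    show "\<exists>s. (s # xs) ! 1 < triangle (Suc ((s # xs) ! 0))"
      by (rule exI[of _ "xs ! 0"]) (simp add: triangle_def)
  qed auto
  then have "recursive 1 (\<lambda>xs. LEAST s. xs ! 0 < triangle (Suc s))"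
    by simp
  then show "recursive k f \<Longrightarrow> recursive k (\<lambda>xs. fst (prod_decode (f xs)))"
    and "recursive k f \<Longrightarrow> recursive k (\<lambda>xs. snd (prod_decode (f xs)))"
    unfolding prod_decode_components
    by (auto intro!: recursive_diff recursive_triangle
        intro: recursive_compose1[of "\<lambda>c. LEAST s. c < triangle (Suc s)"] simp del: triangle_Suc)
qed

section \<open>Codes of rational numbers\<close>

text \<open>
  The positive and negative parts of the integer with code \<open>z\<close>. Working with the two parts lets
  all comparisons of rationals be stated as inequalities between natural numbers.
\<close>

definition code_pos :: "nat \<Rightarrow> nat" where
  "code_pos z = (1 - z mod 2) * (z div 2)"

definition code_neg :: "nat \<Rightarrow> nat" where
  "code_neg z = (z mod 2) * Suc (z div 2)"

lemma int_eq_code_pos_minus_code_neg: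
  "i = int (code_pos (int_encode i)) - int (code_neg (int_encode i))"
  by (simp add: int_encode_def sum_encode_def code_pos_def code_neg_def)

lemma int_encode_pos: "i > 0 \<Longrightarrow> int_encode i = 2 * nat i"
  by (simp add: int_encode_def sum_encode_def)

lemma int_encode_minus:
  "int_encode (- i) = int_encode i + 2 * (int_encode i mod 2) - 1"
  by (auto simp: int_encode_def sum_encode_def nat_diff_distrib)

definition num_code :: "nat \<Rightarrow> nat" where
  "num_code w = fst (prod_decode w)"

text \<open>
  Denominators are coded as integers, and a positive integer \<open>d\<close> has the code \<open>2 * d\<close>.
\<close>

definition denom_of_code :: "nat \<Rightarrow> nat" where
  "denom_of_code w = snd (prod_decode w) div 2"

lemma rat_of_code:
  fixes r :: rat
  defines "w \<equiv> encode r"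
  shows "denom_of_code w > 0"
    and "real_of_rat r =
      (real (code_pos (num_code w)) - real (code_neg (num_code w))) / real (denom_of_code w)"
proof -
  obtain n d where r: "quotient_of r = (n, d)"
    by force
  then have d: "d > 0"
    by (rule quotient_of_denom_pos)
  have w: "num_code w = int_encode n" "denom_of_code w = nat d"
    using d by (simp_all add: w_def num_code_def denom_of_code_def encode_rat_def encode_prod_def
        encode_int_def r int_encode_pos)
  show "denom_of_code w > 0"
    using w d by simp
  have "real_of_rat r = real_of_int n / real_of_int d"
    by (simp add: quotient_of_div[OF r] of_rat_divide)
  moreover have "real_of_int n = real (code_pos (int_encode n)) - real (code_neg (int_encode n))"
    by (metis int_eq_code_pos_minus_code_neg of_int_diff of_int_of_nat_eq)
  ultimately show "real_of_rat r =
      (real (code_pos (num_code w)) - real (code_neg (num_code w))) / real (denom_of_code w)"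
    using w d by simp
qed

text \<open>
  Comparison of a coded rational with the fraction \<open>m / k\<close>, multiplied out to avoid division and
  negative numbers.
\<close>

definition code_less_frac :: "nat \<Rightarrow> nat \<Rightarrow> nat \<Rightarrow> bool" where
  "code_less_frac w m k \<longleftrightarrow>
     code_pos (num_code w) * k < m * denom_of_code w + code_neg (num_code w) * k"

definition frac_less_code :: "nat \<Rightarrow> nat \<Rightarrow> nat \<Rightarrow> bool" where
  "frac_less_code m k w \<longleftrightarrow>
     m * denom_of_code w + code_neg (num_code w) * k < code_pos (num_code w) * k"

lemma code_less_frac_iff:
  assumes "k > 0"
  shows "code_less_frac (encode r) m k \<longleftrightarrow> real_of_rat r < real m / real k"
proof -
  let ?w = "encode r"
  have "real_of_rat r < real m / real k \<longleftrightarrow>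
    real (code_pos (num_code ?w) * k) < real (m * denom_of_code ?w + code_neg (num_code ?w) * k)"
    using assms rat_of_code(1)[of r] unfolding rat_of_code(2) by (simp add: field_simps)
  then show ?thesis
    unfolding code_less_frac_def of_nat_less_iff by simp
qed

lemma frac_less_code_iff:
  assumes "k > 0"
  shows "frac_less_code m k (encode r) \<longleftrightarrow> real m / real k < real_of_rat r"
proof -
  let ?w = "encode r"
  have "real m / real k < real_of_rat r \<longleftrightarrow>
    real (m * denom_of_code ?w + code_neg (num_code ?w) * k) < real (code_pos (num_code ?w) * k)"
    using assms rat_of_code(1)[of r] unfolding rat_of_code(2) by (simp add: field_simps)
  then show ?thesis
    unfolding frac_less_code_def of_nat_less_iff by simp
qed

lemma decidable_code_less_frac [intro!]:
  "recursive n w \<Longrightarrow> recursive n m \<Longrightarrow> recursive n k \<Longrightarrow>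
     decidable n (\<lambda>xs. code_less_frac (w xs) (m xs) (k xs))"
  and decidable_frac_less_code [intro!]:
  "recursive n w \<Longrightarrow> recursive n m \<Longrightarrow> recursive n k \<Longrightarrow>
     decidable n (\<lambda>xs. frac_less_code (m xs) (k xs) (w xs))"
  unfolding code_less_frac_def frac_less_code_def code_pos_def code_neg_def num_code_def
    denom_of_code_def
  by auto

text \<open>
  Negation swaps the integer codes \<open>2 * m\<close> and \<open>2 * m - 1\<close> and fixes 0.
\<close>

lemma encode_minus_rat:
  "encode (- r :: rat) =
    prod_encode (num_code (encode r) + 2 * (num_code (encode r) mod 2) - 1,
      snd (prod_decode (encode r)))"
  by (cases "quotient_of r")
    (simp add: encode_rat_def encode_prod_def encode_int_def num_code_def
      rat_uminus_code int_encode_minus)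

text \<open>
  A fraction with numerator 1 is in lowest terms, so that its code needs no gcd; 2 is the code of the
  integer 1.
\<close>

lemma encode_rat_unit_fraction:
  assumes "m > 0"
  shows "encode (Fract 1 (int m)) = prod_encode (2, 2 * m)"
  using assms
  by (simp add: encode_rat_def encode_prod_def encode_int_def quotient_of_Fract normalize_stable
      int_encode_pos)

section \<open>Isolated points of effectively closed sets are computable\<close>

definition rational_interval :: "rat \<times> rat \<Rightarrow> real set" where
  "rational_interval p = {real_of_rat (fst p)<..<real_of_rat (snd p)}"

text \<open>
  The Lebesgue number of a finite subcover gives one number \<open>k\<close> that serves both as a bound on the
  indices in use and as a mesh: every cell of length \<open>1 / k\<close> that meets \<open>S\<close> lies inside a single
  member of the cover. The factor 2 leaves room for cells that stick out of \<open>S\<close>.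
\<close>

lemma compact_cover_cells:
  fixes G :: "nat \<Rightarrow> real set"
  assumes "compact S" "S \<subseteq> V \<union> (\<Union>j. G j)" "open V" "\<And>j. open (G j)"
  obtains k :: nat where "k > 0"
    "\<And>x. x \<in> S \<Longrightarrow> ball x (2 / k) \<subseteq> V \<or> (\<exists>j\<le>k. ball x (2 / k) \<subseteq> G j)"
proof -
  obtain D where D: "D \<subseteq> insert V (range G)" "finite D" "S \<subseteq> \<Union>D"
    by (rule compactE[of S "insert V (range G)"]) (use assms in auto)
  have "finite (D - {V})" "D - {V} \<subseteq> range G"
    using D by auto
  then obtain F where F: "finite F" "D - {V} = G ` F"
    by (meson finite_subset_image)
  then have "D \<subseteq> insert V (G ` F)"
    by blast
  then have SF: "S \<subseteq> \<Union>(insert V (G ` F))"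
    using D(3) by (meson Union_mono order_trans)
  obtain e where e: "e > 0" "\<And>x. x \<in> S \<Longrightarrow> \<exists>H\<in>insert V (G ` F). ball x e \<subseteq> H"
    by (rule Heine_Borel_lemma[of S "insert V (G ` F)"]) (use assms SF in auto)
  obtain N :: nat where N: "2 / e < N"
    using reals_Archimedean2 by blast
  obtain M where M: "\<forall>j\<in>F. j \<le> M"
    using F(1) finite_nat_set_iff_bounded_le by blast
  let ?k = "max (Suc N) M"
  have "2 / real ?k \<le> e"
  proof -
    have "2 / e < real ?k"
      using N by linarith
    then show ?thesis
      using e(1) by (simp add: field_simps)
  qed
  then have shrink: "ball x (2 / real ?k) \<subseteq> ball x e" for x :: real
    by (rule subset_ball)
  show thesis
  proof (rule that[of ?k])
    fix x assume "x \<in> S"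
    then obtain H where "H = V \<or> H \<in> G ` F" "ball x e \<subseteq> H"
      using e(2)[of x] by auto
    then have H: "H = V \<or> (\<exists>j\<in>F. H = G j)" "ball x (2 / real ?k) \<subseteq> H"
      using order_trans[OF shrink] by auto
    then show "ball x (2 / real ?k) \<subseteq> V \<or> (\<exists>j\<le>?k. ball x (2 / real ?k) \<subseteq> G j)"
      using M max.coboundedI2 by metis
  qed simp
qed

text \<open>
  To approximate \<open>\<theta>\<close> up to \<open>1 / n\<close>, search for naturals \<open>q\<close> and \<open>k\<close> such that every cell
  \<open>[i / k, (i + 1) / k]\<close> that meets a fixed rational neighbourhood of \<open>\<theta>\<close> lies either inside
  \<open>[q / n, (q + 2) / n]\<close> or inside one of the intervals \<open>J 0, \<dots>, J k\<close>. This is a decidable condition.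
  It is satisfiable by compactness, as \<open>\<theta>\<close> is the only point of the neighbourhood that the
  intervals leave uncovered. Whenever it holds, the cell of \<open>\<theta>\<close> is not inside any \<open>J j\<close>, so
  \<open>(q + 1) / n\<close> is a good approximation. Cells are indexed by naturals, whence \<open>\<theta> > 0\<close>.
\<close>

lemma computable_real_isolated_pos:
  fixes J :: "nat \<Rightarrow> rat \<times> rat" and \<theta> e :: real
  assumes J: "recursive 1 (\<lambda>xs. encode (J (xs ! 0)))"
    and out: "\<And>j. \<theta> \<notin> rational_interval (J j)"
    and cover: "\<And>x. 0 < \<bar>x - \<theta>\<bar> \<Longrightarrow> \<bar>x - \<theta>\<bar> < e \<Longrightarrow> \<exists>j. x \<in> rational_interval (J j)"
    and "e > 0" "\<theta> > 0"
  shows "computable_real \<theta>"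
proof -
  obtain h :: nat where h: "1 / e < h" "h > 0"
  proof -
    obtain h :: nat where "1 / e < h"
      using reals_Archimedean2 by blast
    moreover have "0 < 1 / e"
      using \<open>e > 0\<close> by simp
    ultimately show thesis
      using that[of h] by linarith
  qed
  have h_e: "1 / h < e"
    using h \<open>e > 0\<close> by (simp add: field_simps)
  \<comment> \<open>The neighbourhood of \<open>\<theta>\<close> is the interval \<open>[a / h, (a + 1) / h]\<close>.\<close>
  define a where "a = nat \<lfloor>\<theta> * h\<rfloor>"
  have a: "a / h \<le> \<theta>" "\<theta> < Suc a / h"
  proof -
    have "0 \<le> \<theta> * h"
      using \<open>\<theta> > 0\<close> by simp
    then have "real a \<le> \<theta> * h" "\<theta> * h < real (Suc a)"
      unfolding a_def by linarith+
    then show "a / h \<le> \<theta>" "\<theta> < Suc a / h"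
      using h(2) by (simp_all add: field_simps)
  qed
  define inside where "inside j m k \<longleftrightarrow>
    code_less_frac (encode (fst (J j))) m k \<and> frac_less_code (Suc m) k (encode (snd (J j)))" for j m k
  \<comment> \<open>The first two alternatives say that the cell misses the neighbourhood.\<close>
  define covered where "covered i q k n \<longleftrightarrow>
    Suc i * h < a * k \<or> Suc a * k < i * h \<or> q * k \<le> n * i \<and> n * Suc i \<le> (q + 2) * k \<or>
    (\<exists>j\<le>k. inside j i k)" for i q k n
  define good where "good q k n \<longleftrightarrow> 0 < k \<and> (\<forall>i\<le>Suc a * k. covered i q k n)" for q k n
  have inside: "inside j m k \<longleftrightarrow> {m / k..Suc m / k} \<subseteq> rational_interval (J j)" if "k > 0" for j m k
    using that divide_right_mono[of "real m" "real (Suc m)" "real k"]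
    unfolding inside_def rational_interval_def code_less_frac_iff[OF that] frac_less_code_iff[OF that]
    by (fastforce simp del: of_nat_Suc)
  define solves where "solves y n \<longleftrightarrow> good (fst (prod_decode y)) (snd (prod_decode y)) n" for y n
  have solves_dec: "decidable 2 (\<lambda>xs. solves (xs ! 0) (xs ! 1))"
  proof -
    have decode: "fst (prod_decode (encode (J j))) = encode (fst (J j))"
      "snd (prod_decode (encode (J j))) = encode (snd (J j))" for j
      by (simp_all add: encode_prod_def)
    have J1: "recursive 1 (\<lambda>xs. encode (fst (J (xs ! 0))))"
      "recursive 1 (\<lambda>xs. encode (snd (J (xs ! 0))))"
      using recursive_fst_decode[OF J] recursive_snd_decode[OF J] unfolding decode .
    have J': "recursive 4 (\<lambda>ys. encode (fst (J (ys ! 0))))"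
      "recursive 4 (\<lambda>ys. encode (snd (J (ys ! 0))))"
      by (intro recursive_compose1[OF J1(1)] recursive_compose1[OF J1(2)] recursive_nth; simp)+
    have "decidable 4 (\<lambda>ys. inside (ys ! 0) (ys ! 1) (snd (prod_decode (ys ! 2))))"
      unfolding inside_def by (auto intro: J')
    moreover have "recursive 3 (\<lambda>ys. snd (prod_decode (ys ! 1)))"
      by (intro recursive_snd_decode recursive_nth) simp
    ultimately have "decidable 3
      (\<lambda>ys. \<exists>j\<le>snd (prod_decode (ys ! 1)). inside j (ys ! 0) (snd (prod_decode (ys ! 1))))"
      using decidable_Ex_le[of 3 "\<lambda>ys. inside (ys ! 0) (ys ! 1) (snd (prod_decode (ys ! 2)))"
        "\<lambda>ys. snd (prod_decode (ys ! 1))"] by (simp add: numeral_eq_Suc)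
    then have "decidable 3
      (\<lambda>ys. covered (ys ! 0) (fst (prod_decode (ys ! 1))) (snd (prod_decode (ys ! 1))) (ys ! 2))"
      unfolding covered_def
      by (intro decidable_disj decidable_conj decidable_le decidable_less recursive_mult recursive_add
          recursive_Suc recursive_const recursive_fst_decode recursive_snd_decode recursive_nth) simp_all
    moreover have "recursive 2 (\<lambda>xs. Suc a * snd (prod_decode (xs ! 0)))"
      by (intro recursive_mult recursive_const recursive_snd_decode recursive_nth) simp
    ultimately have "decidable 2 (\<lambda>xs. \<forall>i\<le>Suc a * snd (prod_decode (xs ! 0)).
        covered i (fst (prod_decode (xs ! 0))) (snd (prod_decode (xs ! 0))) (xs ! 1))"
      using decidable_All_le[of 2
          "\<lambda>ys. covered (ys ! 0) (fst (prod_decode (ys ! 1))) (snd (prod_decode (ys ! 1))) (ys ! 2)"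
          "\<lambda>xs. Suc a * snd (prod_decode (xs ! 0))"]
      by (simp add: numeral_eq_Suc)
    then show ?thesis
      unfolding solves_def good_def by (intro decidable_conj decidable_less) auto
  qed
  have good_ex: "\<exists>q k. good q k n" for n
    \<comment> \<open>Minimization needs a solution for every argument, hence also for \<open>n = 0\<close>.\<close>
  proof (cases "n = 0")
    case True
    then have "good 0 1 n"
      by (simp add: good_def covered_def)
    then show ?thesis by blast
  next
    case False
    \<comment> \<open>The ceiling makes the bounds on \<open>\<theta>\<close> strict, so that \<open>\<theta>\<close> is interior to \<open>V\<close>.\<close>
    define q where "q = nat (\<lceil>\<theta> * n\<rceil> - 1)"
    have "\<theta> * n > 0"
      using False \<open>\<theta> > 0\<close> by simp
    then have q: "real q < \<theta> * n" "\<theta> * n < real q + 2"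
      unfolding q_def by linarith+
    define V where "V = {real q / n<..<(real q + 2) / n}"
    have "\<theta> \<in> V"
      using q False by (simp add: V_def field_simps)
    have "{real a / h..Suc a / h} \<subseteq> V \<union> (\<Union>j. rational_interval (J j))"
    proof
      fix x assume x: "x \<in> {real a / h..Suc a / h}"
      have "Suc a / h = a / h + 1 / h"
        by (simp add: add_divide_distrib)
      then have "\<bar>x - \<theta>\<bar> < e"
        using x a h_e by (simp only: atLeastAtMost_iff abs_less_iff) linarith
      then show "x \<in> V \<union> (\<Union>j. rational_interval (J j))"
        using cover[of x] \<open>\<theta> \<in> V\<close> by (cases "x = \<theta>") auto
    qed
    then obtain k :: nat where k: "k > 0"
        "\<And>x. x \<in> {real a / h..Suc a / h} \<Longrightarrow>
          ball x (2 / k) \<subseteq> V \<or> (\<exists>j\<le>k. ball x (2 / k) \<subseteq> rational_interval (J j))"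
      by (rule compact_cover_cells[rotated]) (auto simp: V_def rational_interval_def)
    have "good q k n"
      unfolding good_def
    proof (intro conjI allI impI k(1))
      fix i
      show "covered i q k n"
      proof (cases "Suc i * h < a * k \<or> Suc a * k < i * h")
        case False
        then have meets: "real (a * k) \<le> real (Suc i * h)" "real (i * h) \<le> real (Suc a * k)"
          unfolding of_nat_le_iff by auto
        \<comment> \<open>A point of the cell that belongs to the neighbourhood.\<close>
        define x where "x = max (a / h) (i / k)"
        have ik: "a / h \<le> Suc i / k" "i / k \<le> Suc a / h"
          using meets k(1) h(2) by (simp_all add: field_simps)
        have step: "Suc i / k = i / k + 1 / k" "Suc a / h = a / h + 1 / h"
            "1 / real k > 0" "1 / real h > 0"
            "2 / real k = 1 / k + 1 / k"
          using k(1) h(2) by (simp_all add: add_divide_distrib)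
        have "x \<in> {real a / h..Suc a / h}" and x: "i / k \<le> x" "x \<le> Suc i / k"
          using ik step unfolding x_def atLeastAtMost_iff by linarith+
        moreover have cell: "{i / k..Suc i / k} \<subseteq> ball x (2 / k)"
        proof
          fix y assume "y \<in> {i / k..Suc i / k}"
          then have "\<bar>x - y\<bar> < 2 / k"
            using x step unfolding atLeastAtMost_iff by linarith
          then show "y \<in> ball x (2 / k)"
            by (simp add: dist_real_def)
        qed
        ultimately have "{i / k..Suc i / k} \<subseteq> V \<or> (\<exists>j\<le>k. inside j i k)"
          using k(2)[of x] inside[OF k(1)] by (meson order_trans)
        moreover have "q * k \<le> n * i \<and> n * Suc i \<le> (q + 2) * k" if "{i / k..Suc i / k} \<subseteq> V"
        proof -
          have "i / k \<in> V" "Suc i / k \<in> V"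
            using that by (auto simp: divide_right_mono)
          then have "real (q * k) \<le> real (n * i)" "real (n * Suc i) \<le> real ((q + 2) * k)"
            using k(1) \<open>n \<noteq> 0\<close> by (simp_all add: V_def field_simps)
          then show ?thesis
            unfolding of_nat_le_iff by blast
        qed
        ultimately show ?thesis
          unfolding covered_def by blast
      qed (auto simp: covered_def)
    qed
    then show ?thesis by blast
  qed
  have good_correct: "q \<le> \<theta> * n \<and> \<theta> * n \<le> q + 2" if "good q k n" for q k n
  proof -
    have k: "k > 0"
      using that by (simp add: good_def)
    define i where "i = nat \<lfloor>\<theta> * k\<rfloor>"
    have "0 \<le> \<theta> * k"
      using \<open>\<theta> > 0\<close> by simp
    then have i': "i \<le> \<theta> * k" "\<theta> * k < Suc i"
      unfolding i_def by linarith+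
    then have i: "i / k \<le> \<theta>" "\<theta> < Suc i / k"
      using k by (simp_all add: field_simps)
    have meets: "a / h < Suc i / k" "i / k < Suc a / h"
      using a i by linarith+
    then have "real (a * k) < real (Suc i * h)" "real (i * h) < real (Suc a * k)"
      using k h(2) by (simp_all add: field_simps)
    then have meets': "a * k < Suc i * h" "i * h < Suc a * k"
      unfolding of_nat_less_iff by auto
    moreover have "i \<le> Suc a * k"
      using meets'(2) h(2) by (metis le_trans less_imp_le mult.right_neutral mult_le_mono2 Suc_leI
          One_nat_def)
    moreover have "\<not> inside j i k" for j
    proof -
      have "\<theta> \<in> {i / k..Suc i / k}"
        using i by simp
      then show ?thesis
        using inside[OF k, of j i] out[of j] by blast
    qed
    ultimately have "q * k \<le> n * i" "n * Suc i \<le> (q + 2) * k"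
      using that unfolding good_def covered_def by (meson less_asym)+
    then have "real q * k \<le> real n * i" "real n * Suc i \<le> (real q + 2) * k"
      by (metis of_nat_le_iff of_nat_mult, metis of_nat_le_iff of_nat_mult of_nat_add of_nat_numeral)
    moreover have "real n * i \<le> real n * (\<theta> * k)" "real n * (\<theta> * k) \<le> real n * Suc i"
      using i' by (intro mult_left_mono; simp)+
    ultimately have "q * k \<le> (\<theta> * n) * k" "(\<theta> * n) * k \<le> (real q + 2) * k"
      by (simp_all add: ac_simps)
    then show ?thesis
      using k by simp
  qed
  \<comment> \<open>The midpoint of the interval found is \<open>(q + 1) / n\<close>; its numerator is positive as required.\<close>
  define F where "F n = Suc (fst (prod_decode (LEAST y. solves y n)))" for n
  have "recursive 1 (\<lambda>xs. LEAST y. solves ((y # xs) ! 0) ((y # xs) ! 1))"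
  proof (rule recursive_Least)
    fix xs :: "nat list"
    obtain q k where "good q k (xs ! 0)"
      using good_ex by blast
    then show "\<exists>y. solves ((y # xs) ! 0) ((y # xs) ! 1)"
      by (intro exI[of _ "prod_encode (q, k)"]) (simp add: solves_def)
  qed (use solves_dec in \<open>simp add: numeral_2_eq_2\<close>)
  then have "recursive 1 (\<lambda>xs. F (xs ! 0))"
    unfolding F_def by auto
  then have "computable_on {1..} F"
    unfolding computable_on_def recursive_def encode_nat_def by force
  moreover have "\<bar>\<bar>\<theta>\<bar> - F n / n\<bar> \<le> 1 / n" if "n \<ge> 1" for n
  proof -
    obtain q k where "good q k n"
      using good_ex by blast
    then have "solves (prod_encode (q, k)) n"
      by (simp add: solves_def)
    then have "solves (LEAST y. solves y n) n"
      by (rule LeastI)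
    then have "good (F n - 1) (snd (prod_decode (LEAST y. solves y n))) n"
      by (simp add: F_def solves_def)
    from good_correct[OF this] have "\<bar>\<theta> * n - F n\<bar> \<le> 1"
      unfolding F_def diff_Suc_1 of_nat_Suc abs_le_iff by linarith
    moreover have "\<theta> * n - F n = (\<theta> - F n / n) * n"
      using that by (simp add: field_simps)
    ultimately have "\<bar>\<theta> - F n / n\<bar> * n \<le> 1"
      by (simp add: abs_mult)
    then show ?thesis
      using that \<open>\<theta> > 0\<close> by (simp add: field_simps)
  qed
  moreover have "F n \<ge> 1" for n
    by (simp add: F_def)
  ultimately show ?thesis
    unfolding computable_real_def by blast
qed

text \<open>
  A negative point is reduced to a positive one by reflecting all intervals; computability of a real
  is a property of its absolute value. At 0 the approximations \<open>1 / n\<close> do.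
\<close>

lemma computable_real_isolated:
  fixes J :: "nat \<Rightarrow> rat \<times> rat" and \<theta> e :: real
  assumes J: "recursive 1 (\<lambda>xs. encode (J (xs ! 0)))"
    and out: "\<And>j. \<theta> \<notin> rational_interval (J j)"
    and cover: "\<And>x. 0 < \<bar>x - \<theta>\<bar> \<Longrightarrow> \<bar>x - \<theta>\<bar> < e \<Longrightarrow> \<exists>j. x \<in> rational_interval (J j)"
    and "e > 0"
  shows "computable_real \<theta>"
proof (cases \<theta> "0 :: real" rule: linorder_cases)
  case greater
  then show ?thesis
    by (intro computable_real_isolated_pos[OF J out cover \<open>e > 0\<close>])
next
  case equal
  have "computable_on {1..} (\<lambda>n :: nat. 1 :: nat)"
    unfolding computable_on_def encode_nat_def
    using recursive_const[of 1 1] unfolding recursive_def by force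
  then show ?thesis
    unfolding computable_real_def equal by fastforce
next
  case less
  define J' where "J' j = (- snd (J j), - fst (J j))" for j
  have J': "x \<in> rational_interval (J' j) \<longleftrightarrow> - x \<in> rational_interval (J j)" for x j
    by (auto simp: J'_def rational_interval_def of_rat_minus)
  define neg where
    "neg w = prod_encode (num_code w + 2 * (num_code w mod 2) - 1, snd (prod_decode w))" for w
  have "encode (J' j) = 
      prod_encode (neg (snd (prod_decode (encode (J j)))), neg (fst (prod_decode (encode (J j)))))"
    for j
    by (simp add: J'_def neg_def encode_prod_def encode_minus_rat)
  then have "recursive 1 (\<lambda>xs. encode (J' (xs ! 0)))"
    using J by (auto simp: neg_def num_code_def)
  then have "computable_real (- \<theta>)"
  proof (rule computable_real_isolated_pos[OF _ _ _ \<open>e > 0\<close>])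
    show "- \<theta> \<notin> rational_interval (J' j)" for j
      using out by (simp add: J')
    show "\<exists>j. x \<in> rational_interval (J' j)" if "0 < \<bar>x - - \<theta>\<bar>" "\<bar>x - - \<theta>\<bar> < e" for x
      using cover[of "- x"] that by (simp add: J' abs_minus_commute)
  qed (use less in simp)
  then show ?thesis
    unfolding computable_real_def by simp
qed

text \<open>
  The intervals enumerated for the complements of all \<open>A (f l)\<close> are listed in one sequence by
  decoding its index into a pair of positions. The enumeration starts with index 1, whence \<open>Suc\<close>.
\<close>

lemma computable_real_isolated_Inter:
  fixes A :: "'x::finite_object \<Rightarrow> real set" and f :: "nat \<Rightarrow> 'x"
  assumes A: "effectively_closed_on X A"
    and f: "recursive 1 (\<lambda>xs. encode (f (xs ! 0)))" "\<And>l. f l \<in> X"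
    and mem: "\<And>l. \<theta> \<in> A (f l)"
    and isolated: "\<And>x. 0 < \<bar>x - \<theta>\<bar> \<Longrightarrow> \<bar>x - \<theta>\<bar> < e \<Longrightarrow> \<exists>l. x \<notin> A (f l)" "e > 0"
  shows "computable_real \<theta>"
proof -
  obtain a b :: "nat \<Rightarrow> 'x \<Rightarrow> rat" where
    comp: "computable_on ({1..} \<times> X) (\<lambda>(i, x). (a i x, b i x))" and
    AX: "\<And>x. x \<in> X \<Longrightarrow> - A x = (\<Union>i\<in>{1..}. {real_of_rat (a i x)<..<real_of_rat (b i x)})"
    using A unfolding effectively_closed_on_def effectively_open_on_def by blast
  obtain g where g: "total_recursive 1 g"
    "\<And>i x. i \<ge> 1 \<Longrightarrow> x \<in> X \<Longrightarrow> g [encode (i, x)] = encode (a i x, b i x)"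
  proof -
    obtain g where "total_recursive 1 g"
      "\<forall>z\<in>{1..} \<times> X. g [encode z] = encode (case z of (i, x) \<Rightarrow> (a i x, b i x))"
      using comp unfolding computable_on_def by blast
    then show thesis
      by (intro that[of g]) auto
  qed
  define J where "J j = (a (Suc (fst (prod_decode j))) (f (snd (prod_decode j))),
    b (Suc (fst (prod_decode j))) (f (snd (prod_decode j))))" for j
  have J: "encode (J j) =
      g [prod_encode (Suc (fst (prod_decode j)), encode (f (snd (prod_decode j))))]" for j
    using g(2)[OF _ f(2)] by (simp add: J_def encode_prod_def encode_nat_def)
  have union: "(\<Union>j. rational_interval (J j)) = (\<Union>l. - A (f l))"
  proof -
    have "(\<Union>j. rational_interval (J j)) = (\<Union>p. rational_interval (J (prod_encode p)))"
      by (metis bij_prod_encode bij_is_surj image_image)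
    also have "\<dots> = (\<Union>i l. {real_of_rat (a (Suc i) (f l))<..<real_of_rat (b (Suc i) (f l))})"
      by (fastforce simp: J_def rational_interval_def)
    also have "\<dots> = (\<Union>l. \<Union>i\<in>range Suc. {real_of_rat (a i (f l))<..<real_of_rat (b i (f l))})"
      by (subst SUP_commute) simp
    also have "range Suc = {1..}"
      by (auto simp: image_iff Suc_le_eq gr0_conv_Suc)
    finally show ?thesis
      using AX[OF f(2)] by simp
  qed
  show ?thesis
  proof (rule computable_real_isolated[OF _ _ _ \<open>e > 0\<close>])
    have g': "recursive 1 (\<lambda>xs. g [xs ! 0])"
      by (rule recursive_cong[OF recursive_total[OF g(1)]]) (auto simp: length_Suc_conv)
    have "recursive 1 (\<lambda>xs. encode (f (snd (prod_decode (xs ! 0)))))"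
      by (rule recursive_compose1[OF f(1)]) auto
    then show "recursive 1 (\<lambda>xs. encode (J (xs ! 0)))"
      unfolding J by (intro recursive_compose1[OF g']) auto
    show "\<theta> \<notin> rational_interval (J j)" for j
      using union mem by blast
    show "\<exists>j. x \<in> rational_interval (J j)" if "0 < \<bar>x - \<theta>\<bar>" "\<bar>x - \<theta>\<bar> < e" for x
      using union isolated(1)[OF that] by blast
  qed
qed

section \<open>Affinity and accurate estimators\<close>

lemma isCont_std_normal_cdf: "isCont std_normal_cdf x"
proof -
  interpret real_distribution std_normal_distribution
    by (rule real_dist_normal_dist)
  have "AE y in lborel. y \<noteq> x"
    by (rule AE_lborel_singleton)
  then have "AE y in std_normal_distribution. y \<notin> {x}"
    by (auto simp: AE_density elim: eventually_mono)
  then have "emeasure std_normal_distribution {x} = 0"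
    using emeasure_eq_0_AE[of "\<lambda>y. y \<in> {x}" std_normal_distribution] by simp
  then show ?thesis
    by (simp add: isCont_cdf measure_def)
qed

lemma affinity_le:
  assumes "E \<in> sets P"
    and "measure P E \<le> \<delta>" "measure Q (space P - E) \<le> \<delta>"
  shows "affinity P Q \<le> \<delta>"
proof -
  have "affinity P Q \<le> max (measure P E) (measure Q (space P - E))"
    unfolding affinity_def
    by (rule cINF_lower[OF _ assms(1)]) (auto intro!: bdd_belowI[of _ 0] simp: le_max_iff_disj)
  then show ?thesis
    using assms(2,3) by simp
qed

text \<open>
  An outcome within \<open>u\<close> of \<open>x\<close> is at distance more than \<open>u\<close> from \<open>y\<close> when \<open>x\<close> and \<open>y\<close> are more
  than \<open>2 * u\<close> apart. So the event that \<open>T\<close> misses \<open>x\<close> is a test of \<open>P\<close> against \<open>Q\<close> with both errors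
  at most \<open>\<delta>\<close>.
\<close>

lemma affinity_le_of_accurate_estimator:
  fixes T :: "'a \<Rightarrow> real"
  assumes prob: "prob_space Q"
    and sets: "sets P = sets M" "sets Q = sets M"
    and T: "T \<in> borel_measurable M"
    and P: "measure P {\<omega> \<in> space M. \<bar>T \<omega> - x\<bar> > u} \<le> \<delta>"
    and Q: "measure Q {\<omega> \<in> space M. \<bar>T \<omega> - y\<bar> > u} \<le> \<delta>"
    and far: "2 * u < \<bar>y - x\<bar>"
  shows "affinity P Q \<le> \<delta>"
proof (rule affinity_le)
  have space: "space P = space M"
    using sets sets_eq_imp_space_eq by blast
  interpret Q: prob_space Q by fact
  show "{\<omega> \<in> space M. \<bar>T \<omega> - x\<bar> > u} \<in> sets P"
    unfolding sets using T by measurable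
  have "measure Q (space P - {\<omega> \<in> space M. \<bar>T \<omega> - x\<bar> > u})
      \<le> measure Q {\<omega> \<in> space M. \<bar>T \<omega> - y\<bar> > u}"
  proof (rule Q.finite_measure_mono)
    show "{\<omega> \<in> space M. \<bar>T \<omega> - y\<bar> > u} \<in> sets Q"
      unfolding sets using T by measurable
  qed (use far space in auto)
  also note Q
  finally show "measure Q (space P - {\<omega> \<in> space M. \<bar>T \<omega> - x\<bar> > u}) \<le> \<delta>" .
qed (fact P)

section \<open>Computable estimators at noncomputable parameters\<close>

theorem theorem1:
  fixes \<Omega> :: "nat \<Rightarrow> 'a measure"
    and \<alpha> \<beta> :: ereal
    and \<Theta> :: "real set"
    and P :: "nat \<Rightarrow> real \<Rightarrow> 'a measure"
    and I :: "real \<Rightarrow> real"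
    and T :: "nat \<Rightarrow> 'a \<Rightarrow> real"
    and c \<theta> :: real
  assumes interval: "\<alpha> < \<beta>" "\<Theta> = einterval \<alpha> \<beta>"
    and endpoints: "computable_endpoint \<alpha>" "computable_endpoint \<beta>"
    and models: "statistical_models \<Omega> \<Theta> P"
    and I_cont: "continuous_on \<Theta> I"
    and I_pos: "\<forall>t\<in>\<Theta>. I t > 0"
    and A: "assumption_A \<Theta> I P"
    and T: "computable_estimator \<Omega> \<Theta> P T"
    and c: "c > 0"
    and \<theta>: "\<theta> \<in> \<Theta>" "\<not> computable_real \<theta>"
  shows "limsup (\<lambda>n. ereal (measure (P n \<theta>)
             {\<omega> \<in> space (\<Omega> n). \<bar>T n \<omega> - \<theta>\<bar> > c * real n powr (- 1 / 2)}))
           \<ge> ereal (std_normal_cdf (- c * sqrt (I \<theta>)))"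
proof (rule ccontr)
  let ?\<Phi> = "std_normal_cdf" and ?s = "sqrt (I \<theta>)"
  interpret normal: real_distribution std_normal_distribution
    by (rule real_dist_normal_dist)
  define p where "p n = measure (P n \<theta>)
    {\<omega> \<in> space (\<Omega> n). \<bar>T n \<omega> - \<theta>\<bar> > c * real n powr (- 1 / 2)}" for n
  assume "\<not> ?thesis"
  then have "limsup (\<lambda>n. ereal (p n)) < ereal (?\<Phi> (- c * ?s))"
    unfolding p_def not_le .
  then obtain d where d: "limsup (\<lambda>n. ereal (p n)) < ereal d" "d < ?\<Phi> (- c * ?s)"
    using ereal_dense2 by fastforce
  from Limsup_lessD[OF d(1)] obtain N\<^sub>0 where N\<^sub>0: "\<And>n. n \<ge> N\<^sub>0 \<Longrightarrow> p n < d"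
    unfolding eventually_sequentially by auto
  have "0 \<le> p N\<^sub>0"
    by (simp add: p_def)
  then have "0 < d"
    using N\<^sub>0[of N\<^sub>0] by simp
  obtain \<delta> :: rat where \<delta>: "d < real_of_rat \<delta>" "real_of_rat \<delta> < ?\<Phi> (- c * ?s)"
    using of_rat_dense[OF d(2)] by blast
  have "real_of_rat \<delta> < 1"
    using \<delta>(2) normal.cdf_bounded_prob[of "- c * ?s"] by linarith
  then have \<delta>01: "0 \<le> \<delta>" "\<delta> < 1"
    using \<delta>(1) \<open>0 < d\<close> by (metis less_le_trans not_le of_rat_less_0_iff less_asym, simp)

  have "isCont (\<lambda>t. ?\<Phi> (- t * ?s)) c"
    by (rule isCont_o2[OF _ isCont_std_normal_cdf]) (intro continuous_intros)
  then have "\<forall>\<^sub>F t in at c. real_of_rat \<delta> < ?\<Phi> (- t * ?s)"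
    using \<delta>(2) unfolding isCont_def by (rule order_tendstoD)
  then have "\<forall>\<^sub>F t in at_right c. real_of_rat \<delta> < ?\<Phi> (- t * ?s)"
    by (simp add: eventually_at_split)
  then obtain b where b: "b > c" "\<And>t. c < t \<Longrightarrow> t < b \<Longrightarrow> real_of_rat \<delta> < ?\<Phi> (- t * ?s)"
    unfolding eventually_at_right_field by blast
  define c' where "c' = (c + b) / 2"
  have c': "c < c'" "real_of_rat \<delta> < ?\<Phi> (- c' * ?s)"
    using b(1) b(2)[of c'] by (simp_all add: c'_def)
  \<comment> \<open>\<open>k / q\<close> is the rational number between \<open>c\<close> and \<open>c'\<close>.\<close>
  obtain q k :: nat where qk: "c * q < k" "k < c' * q" "q > 0" "k > 0"
  proof -
    obtain q :: nat where q: "1 / (c' - c) < q"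
      using reals_Archimedean2 by blast
    then have gap: "c * q + 1 < c' * q"
      using c'(1) by (simp add: field_simps)
    have "0 < 1 / (c' - c)"
      using c'(1) by simp
    then have "q > 0"
      using q by linarith
    define k where "k = nat (\<lfloor>c * q\<rfloor> + 1)"
    have "0 < c * q"
      using c \<open>q > 0\<close> by simp
    then have "c * q < k" "k \<le> c * q + 1" "k > 0"
      unfolding k_def by linarith+
    then show thesis
      using gap \<open>q > 0\<close> by (intro that[of q k]) simp_all
  qed

  \<comment> \<open>Half the gap: an affinity at most \<open>\<delta>\<close> then contradicts the lower bound with \<open>c'\<close> strictly.\<close>
  define \<epsilon> where "\<epsilon> = (?\<Phi> (- c' * ?s) - real_of_rat \<delta>) / 2"
  have "\<epsilon> > 0"
    using c'(2) by (simp add: \<epsilon>_def)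
  from A[unfolded assumption_A_def, rule_format, OF this \<theta>(1)]
  obtain N U where U: "open U" "\<theta> \<in> U" "U \<subseteq> \<Theta>" and
    aff: "\<And>n t u. n \<ge> N \<Longrightarrow> t \<in> U \<Longrightarrow> u \<in> U \<Longrightarrow>
      affinity (P n t) (P n u) \<ge> ?\<Phi> (- (\<bar>u - t\<bar> * sqrt (real n * I \<theta>) / 2)) - \<epsilon>"
    by blast
  obtain e\<^sub>0 where e\<^sub>0: "e\<^sub>0 > 0" "ball \<theta> e\<^sub>0 \<subseteq> U"
    using U(1,2) open_contains_ball by blast
  define M where "M = Suc (N + N\<^sub>0)"
  then have "M > 0"
    by simp

  define S where "S n u = {t \<in> \<Theta>. measure (P n t) {\<omega> \<in> space (\<Omega> n). \<bar>T n \<omega> - t\<bar> > real_of_rat u}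
      \<le> real_of_rat \<delta>}" for n u
  \<comment> \<open>Sample size \<open>n L\<close> and tolerance \<open>u L\<close> satisfy \<open>u L = (k / q) / sqrt (n L)\<close> for \<open>L > 0\<close>.\<close>
  define n where "n L = (k * L) * (k * L)" for L
  define u where "u L = Fract 1 (int (q * L))" for L
  have u: "real_of_rat (u L) = 1 / (q * L)" for L
    by (simp add: u_def Fract_of_int_quotient of_rat_divide of_rat_mult)
  have n_ge: "n L \<ge> L" for L
    using qk(4) by (cases k; cases L) (simp_all add: n_def)
  have sqrt_n: "sqrt (n L) = k * L" for L
    by (simp add: n_def)
  have prob: "prob_space (P m t)" "sets (P m t) = sets (\<Omega> m)" if "m \<ge> 1" "t \<in> \<Theta>" for m t
    using models that unfolding statistical_models_def by auto
  have T_meas: "T m \<in> borel_measurable (\<Omega> m)" if "m \<ge> 1" for m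
    using T that unfolding computable_estimator_def estimator_def
    by (metis measurable_restrict_space2_iff)

  have mem: "\<theta> \<in> S (n L) (u L)" if "L \<ge> M" for L
  proof -
    have L: "L \<ge> 1" "n L \<ge> N\<^sub>0" "n L \<ge> 1"
      using that n_ge[of L] by (simp_all add: M_def)
    interpret prob_space "P (n L) \<theta>"
      using prob L \<theta> by blast
    have "real (n L) powr (- 1 / 2) = 1 / (k * L)"
      using L(3) sqrt_n[of L] by (simp add: powr_minus_divide powr_half_sqrt)
    moreover have "c * (1 / (k * L)) \<le> 1 / (q * L)"
      using qk L(1) by (simp add: field_simps)
    ultimately have "c * real (n L) powr (- 1 / 2) \<le> 1 / (q * L)"
      by (simp only:)
    then have "measure (P (n L) \<theta>) {\<omega> \<in> space (\<Omega> (n L)). \<bar>T (n L) \<omega> - \<theta>\<bar> > 1 / (q * L)} \<le> p (n L)"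
      unfolding p_def
    proof (intro finite_measure_mono)
      show "{\<omega> \<in> space (\<Omega> (n L)). \<bar>T (n L) \<omega> - \<theta>\<bar> > c * real (n L) powr (- 1 / 2)} \<in> events"
        unfolding prob(2)[OF L(3) \<theta>(1)] using T_meas[OF L(3)] by measurable
    qed auto
    then show ?thesis
      using N\<^sub>0[OF L(2)] \<delta>(1) \<theta>(1) by (simp add: S_def u)
  qed

  have separated: "y \<notin> S (n L) (u L)"
    if "L \<ge> M" "y \<in> U" "2 / (q * L) < \<bar>y - \<theta>\<bar>" "\<bar>y - \<theta>\<bar> < 2 * c' / (k * L)" for L y
  proof
    assume y: "y \<in> S (n L) (u L)"
    have L: "L \<ge> 1" "n L \<ge> N" "n L \<ge> 1"
      using that n_ge[of L] by (simp_all add: M_def)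
    have "y \<in> \<Theta>"
      using that U by blast
    have "affinity (P (n L) \<theta>) (P (n L) y) \<le> real_of_rat \<delta>"
      using mem[OF that(1)] y that(3)
      by (intro affinity_le_of_accurate_estimator[where M = "\<Omega> (n L)" and T = "T (n L)"
            and x = \<theta> and y = y and u = "real_of_rat (u L)"]
          prob T_meas L \<theta> \<open>y \<in> \<Theta>\<close>) (simp_all add: S_def u)
    moreover have "?\<Phi> (- (\<bar>y - \<theta>\<bar> * sqrt (real (n L) * I \<theta>) / 2)) - \<epsilon> \<le> affinity (P (n L) \<theta>) (P (n L) y)"
      by (rule aff[OF L(2) U(2) that(2)])
    moreover have "?\<Phi> (- c' * ?s) \<le> ?\<Phi> (- (\<bar>y - \<theta>\<bar> * sqrt (real (n L) * I \<theta>) / 2))"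
    proof (rule normal.cdf_nondecreasing)
      have "\<bar>y - \<theta>\<bar> * (k * L) / 2 \<le> c'"
        using that(4) L(1) qk(4) by (simp add: field_simps)
      then have "\<bar>y - \<theta>\<bar> * (k * L) / 2 * ?s \<le> c' * ?s"
        using I_pos \<theta>(1) by (intro mult_right_mono) auto
      then show "- c' * ?s \<le> - (\<bar>y - \<theta>\<bar> * sqrt (real (n L) * I \<theta>) / 2)"
        by (simp add: real_sqrt_mult sqrt_n mult_ac)
    qed
    ultimately show False
      using \<open>\<epsilon> > 0\<close> by (simp add: \<epsilon>_def field_simps)
  qed

  \<comment> \<open>The windows \<open>(2 / (q * L), 2 * c' / (k * L))\<close> for \<open>L \<ge> M\<close> cover \<open>(0, e)\<close>: a distance \<open>d\<close> lies in
    the window of \<open>L\<close> iff \<open>L\<close> is between \<open>2 / (q * d)\<close> and \<open>2 * c' / (k * d)\<close>. These bounds differ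
    by \<open>2 * \<kappa> / d\<close>, which exceeds 1 for \<open>d < 2 * \<kappa>\<close>, and the lower one is at least \<open>M\<close> for
    \<open>d \<le> 2 / (q * M)\<close>.\<close>
  define \<kappa> where "\<kappa> = c' / k - 1 / q"
  have "\<kappa> > 0"
    using qk by (simp add: \<kappa>_def field_simps)
  define e where "e = Min {e\<^sub>0, 2 * \<kappa>, 2 / (q * M)}"
  have e: "e > 0" "e \<le> e\<^sub>0" "e \<le> 2 * \<kappa>" "e \<le> 2 / (q * M)"
    using e\<^sub>0 \<open>\<kappa> > 0\<close> \<open>M > 0\<close> qk by (simp_all add: e_def)

  have "computable_real \<theta>"
  proof (rule computable_real_isolated_Inter[where f = "\<lambda>l. (n (l + M), u (l + M))", OF _ _ _ _ _ e(1)])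
    show "effectively_closed_on ({1..} \<times> {0..}) (\<lambda>(n, u). closure (S n u))"
      using T \<delta>01 unfolding computable_estimator_def S_def by blast
    have "encode (n (l + M), u (l + M)) =
        prod_encode ((k * (l + M)) * (k * (l + M)), prod_encode (2, 2 * (q * (l + M))))" for l
      using qk(3) unfolding u_def
      by (subst encode_prod_def, subst snd_conv, subst encode_rat_unit_fraction)
        (simp_all add: n_def encode_nat_def M_def)
    then show "recursive 1 (\<lambda>xs. encode (n (xs ! 0 + M), u (xs ! 0 + M)))"
      by auto
    show "(n (l + M), u (l + M)) \<in> {1..} \<times> {0..}" for l
    proof -
      have "n (l + M) \<ge> 1"
        using n_ge[of "l + M"] by (simp add: M_def)
      moreover have "0 \<le> real_of_rat (u (l + M))"
        by (simp add: u)
      ultimately show ?thesis by simp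
    qed
    show "\<theta> \<in> (case (n (l + M), u (l + M)) of (n, u) \<Rightarrow> closure (S n u))" for l
      using mem[of "l + M"] closure_subset by auto
    fix x assume x: "0 < \<bar>x - \<theta>\<bar>" "\<bar>x - \<theta>\<bar> < e"
    let ?d = "\<bar>x - \<theta>\<bar>"
    define L where "L = nat \<lfloor>2 / (q * ?d)\<rfloor> + 1"
    have "0 \<le> 2 / (q * ?d)"
      by simp
    then have L: "2 / (q * ?d) < L" "L \<le> 2 / (q * ?d) + 1"
      unfolding L_def by linarith+
    have "?d < 2 * c' / k - 2 / q"
      using x(2) e(3) by (simp add: \<kappa>_def)
    then have "1 < (2 * c' / k - 2 / q) / ?d"
      using x(1) by (simp add: less_divide_eq)
    also have "\<dots> = 2 * c' / (k * ?d) - 2 / (q * ?d)"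
      by (simp add: diff_divide_distrib)
    finally have "L < 2 * c' / (k * ?d)"
      using L(2) by linarith
    moreover have "?d \<le> 2 / (q * M)"
      using x(2) e(4) by linarith
    then have "M \<le> 2 / (q * ?d)"
      using x(1) qk(3) \<open>M > 0\<close> by (simp add: field_simps)
    then have "L \<ge> M"
      using L(1) by linarith
    ultimately have d: "2 / (q * L) < ?d" "?d < 2 * c' / (k * L)"
      using L(1) x(1) qk \<open>M > 0\<close> by (simp_all add: field_simps)
    have "x \<notin> closure (S (n L) (u L))"
    proof
      assume "x \<in> closure (S (n L) (u L))"
      \<comment> \<open>The window and the ball around \<open>\<theta>\<close> are open, so they contain points of the set itself near \<open>x\<close>.\<close>
      moreover define r where "r = Min {?d - 2 / (q * L), 2 * c' / (k * L) - ?d, e\<^sub>0 - ?d}"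
      have "r > 0"
        using d x(2) e(2) by (simp add: r_def)
      ultimately obtain y where y: "y \<in> S (n L) (u L)" "dist y x < r"
        unfolding closure_approachable by blast
      have r: "r \<le> ?d - 2 / (q * L)" "r \<le> 2 * c' / (k * L) - ?d" "r \<le> e\<^sub>0 - ?d"
        unfolding r_def by (rule Min_le; simp)+
      have "\<bar>y - \<theta>\<bar> < e\<^sub>0" "2 / (q * L) < \<bar>y - \<theta>\<bar>" "\<bar>y - \<theta>\<bar> < 2 * c' / (k * L)"
        using y(2) r unfolding dist_real_def by linarith+
      moreover from this have "y \<in> U"
        using e\<^sub>0(2) by (auto simp: dist_real_def abs_minus_commute)
      ultimately show False
        using separated[OF \<open>L \<ge> M\<close>] y(1) by blast
    qed
    then show "\<exists>l. x \<notin> (case (n (l + M), u (l + M)) of (n, u) \<Rightarrow> closure (S n u))"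
      using \<open>L \<ge> M\<close> by (intro exI[of _ "L - M"]) simp
  qed
  then show False
    using \<theta>(2) by blast
qed

end
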